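(* Let $r\ge0$, $\mathcal{C}=C([-r,0])$, $a\in C(\mathbb{R})$, and let $B:\mathbb{R}\times\mathcal{C}\to\mathbb{R}$ be continuous. Assume that for any compact interval $J\subset\mathbb{R}$ and any $R>0$ there is $L>0$ such that $|B(t,\phi)-B(t,\phi')|\le L\|\phi-\phi'\|$ for all $t\in J$ and all $\phi,\phi'\in\mathcal{C}$ with $\|\phi\|,\|\phi'\|\le R$, and that there is a nonnegative function $b\in C(\mathbb{R})$ with $$|B(t,\phi)|\le b(t)\|\phi\|,\qquad (t,\phi)\in\mathbb{R}\times\mathcal{C}.$$ Assume moreover that $\int_s^{s+t}a(\sigma)\,d\sigma\to\infty$ as $t\to\infty$ uniformly with respect to $s\in\mathbb{R}$. Put $$E(t,s)=\exp\Big(-\int_s^ta(\sigma)\,d\sigma\Big),\qquad K(t,s)=E(t,s)b(s),$$ and for each $\tau\in\mathbb{R}$ $$\vartheta_\tau=\sup_{t\ge s\ge\tau}E(t,s),\qquad \kappa_\tau=\sup_{t\ge\tau}\int_\tau^tK(t,s)\,ds .$$ Then the null solution of $$\dot x=-a(t)x+B(t,x_t)$$ is globally asymptotically stable (GAS) if $\kappa_\tau<1$ for all $\tau\in\mathbb{R}$. If, further, $\kappa_\tau<1/(1+\vartheta_\tau)$ for all $\tau\in\mathbb{R}$, then it is globally exponentially asymptotically stable (GEAS).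
   Context: $\mathcal{C}=C([-r,0])$ carries the sup-norm $\|\cdot\|$; $x_t\in\mathcal{C}$ is the lift $x_t(s)=x(t+s)$, $s\in[-r,0]$. For $(\tau,\phi)\in\mathbb{R}\times\mathcal{C}$, $x(t;\tau,\phi)$ ($t\ge\tau$) denotes the unique (global) solution of the scalar equation with $x_\tau=\phi$. $\mathcal{B}_R$ denotes the ball in $\mathcal{C}$ centered at $0$ with radius $R$. The null solution $0$ is called: GAS if (i) it is stable: for every $\tau\in\mathbb{R}$ and $\varepsilon>0$ there exists $\delta>0$ such that $|x(t;\tau,\phi)|<\varepsilon$ for all $t\ge\tau$ and $\phi\in\mathcal{B}_\delta$; and (ii) it is globally attracting: $x(t;\tau,\phi)\to0$ as $t\to\infty$ for every $(\tau,\phi)\in\mathbb{R}\times\mathcal{C}$. GEAS if for every $\tau\in\mathbb{R}$ there exist constants $M,\lambda>0$ such that $|x(t;\tau,\phi)|\le M\|\phi\|e^{-\lambda(t-\tau)}$ for all $t\ge\tau$ and $\phi\in\mathcal{C}$. *)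

theory Defs
  imports "HOL-Analysis.Analysis"
begin

text \<open>
  Elements of \<open>C([-r,0])\<close> are functions \<open>real \<Rightarrow> real\<close> that take the value \<open>undefined\<close> outside
  \<open>{-r..0}\<close> (the convention of \<open>cfunspace\<close>), so that equality of elements is equality on \<open>[-r,0]\<close>.
\<close>

definition Cspace :: "real \<Rightarrow> (real \<Rightarrow> real) metric" where
  "Cspace r = cfunspace (top_of_set {-r..0}) euclidean_metric"

definition Cset :: "real \<Rightarrow> (real \<Rightarrow> real) set" where
  "Cset r = mspace (Cspace r)"

definition sup_norm :: "real \<Rightarrow> (real \<Rightarrow> real) \<Rightarrow> real" where
  "sup_norm r \<phi> = (SUP s\<in>{-r..0}. \<bar>\<phi> s\<bar>)"

lemma mem_Cset_iff:
  "\<phi> \<in> Cset r \<longleftrightarrow> \<phi> \<in> extensional {-r..0} \<and> continuous_on {-r..0} \<phi>"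
proof -
  have "bounded (\<phi> ` {-r..0})" if "continuous_on {-r..0} \<phi>"
    using that compact_continuous_image compact_imp_bounded compact_Icc by blast
  then show ?thesis
    by (auto simp: Cset_def Cspace_def)
qed

lemma mdist_Cspace:
  assumes "r \<ge> 0" "\<phi> \<in> Cset r" "\<psi> \<in> Cset r"
  shows "mdist (Cspace r) \<phi> \<psi> = sup_norm r (\<lambda>s. \<phi> s - \<psi> s)"
proof -
  have "\<phi> \<in> Metric_space.fspace UNIV dist {-r..0}" "\<psi> \<in> Metric_space.fspace UNIV dist {-r..0}"
    using assms(2,3) by (auto simp: Cset_def Cspace_def Metric_space.fspace_def[OF Met_TC.Metric_space_axioms])
  then show ?thesis
    using assms(1)
    by (simp add: Cspace_def sup_norm_def mdist_cfunspace_eq_mdist_funspace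
        Metric_space.fdist_def[OF Met_TC.Metric_space_axioms] dist_real_def)
qed

text \<open>The segment \<open>x\<^sub>t \<in> C([-r,0])\<close>, \<open>x\<^sub>t(s) = x(t + s)\<close>.\<close>

definition segment :: "real \<Rightarrow> (real \<Rightarrow> real) \<Rightarrow> real \<Rightarrow> (real \<Rightarrow> real)" where
  "segment r x t = (\<lambda>s\<in>{-r..0}. x (t + s))"

text \<open>\<open>x\<close> solves \<open>x' = -a(t) x + B(t, x\<^sub>t)\<close> on \<open>[\<tau>, \<infinity>)\<close> with \<open>x\<^sub>\<tau> = \<phi>\<close>; the derivative at \<open>\<tau>\<close> is
  one-sided.\<close>

definition is_solution ::
  "real \<Rightarrow> (real \<Rightarrow> real) \<Rightarrow> (real \<Rightarrow> (real \<Rightarrow> real) \<Rightarrow> real) \<Rightarrow> real \<Rightarrow> (real \<Rightarrow> real)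
    \<Rightarrow> (real \<Rightarrow> real) \<Rightarrow> bool" where
  "is_solution r a B \<tau> \<phi> x \<longleftrightarrow>
     segment r x \<tau> = \<phi> \<and> continuous_on {\<tau> - r..} x \<and>
     (\<forall>t\<ge>\<tau>. (x has_real_derivative (- a t * x t + B t (segment r x t))) (at t within {\<tau>..}))"

text \<open>
  The value \<open>x(t; \<tau>, \<phi>)\<close>, meaningful for \<open>t \<ge> \<tau> - r\<close>. The description is on values because
  \<open>is_solution\<close> leaves \<open>x\<close> arbitrary on \<open>(-\<infinity>, \<tau> - r)\<close>. It denotes nothing specific
  unless a global solution exists and all of them agree at \<open>t\<close>.
\<close>

definition sol ::
  "real \<Rightarrow> (real \<Rightarrow> real) \<Rightarrow> (real \<Rightarrow> (real \<Rightarrow> real) \<Rightarrow> real) \<Rightarrow> real \<Rightarrow> (real \<Rightarrow> real)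
    \<Rightarrow> real \<Rightarrow> real" where
  "sol r a B \<tau> \<phi> t = (THE y. \<exists>x. is_solution r a B \<tau> \<phi> x \<and> x t = y)"

definition GAS :: "real \<Rightarrow> (real \<Rightarrow> real) \<Rightarrow> (real \<Rightarrow> (real \<Rightarrow> real) \<Rightarrow> real) \<Rightarrow> bool" where
  "GAS r a B \<longleftrightarrow>
     (\<forall>\<tau>. \<forall>\<epsilon>>0. \<exists>\<delta>>0. \<forall>t\<ge>\<tau>. \<forall>\<phi>\<in>Cset r. sup_norm r \<phi> < \<delta> \<longrightarrow> \<bar>sol r a B \<tau> \<phi> t\<bar> < \<epsilon>) \<and>
     (\<forall>\<tau>. \<forall>\<phi>\<in>Cset r. (sol r a B \<tau> \<phi> \<longlongrightarrow> 0) at_top)"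

definition GEAS :: "real \<Rightarrow> (real \<Rightarrow> real) \<Rightarrow> (real \<Rightarrow> (real \<Rightarrow> real) \<Rightarrow> real) \<Rightarrow> bool" where
  "GEAS r a B \<longleftrightarrow>
     (\<forall>\<tau>. \<exists>M>0. \<exists>\<gamma>>0. \<forall>t\<ge>\<tau>. \<forall>\<phi>\<in>Cset r.
        \<bar>sol r a B \<tau> \<phi> t\<bar> \<le> M * sup_norm r \<phi> * exp (- \<gamma> * (t - \<tau>)))"

text \<open>\<open>E(t,s)\<close> and \<open>K(t,s)\<close> are used for \<open>s \<le> t\<close> only.\<close>

definition E :: "(real \<Rightarrow> real) \<Rightarrow> real \<Rightarrow> real \<Rightarrow> real" where
  "E a t s = exp (- integral {s..t} a)"

definition K :: "(real \<Rightarrow> real) \<Rightarrow> (real \<Rightarrow> real) \<Rightarrow> real \<Rightarrow> real \<Rightarrow> real" where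
  "K a b t s = E a t s * b s"

text \<open>The suprema may be infinite, hence are taken in \<open>ereal\<close>, where \<open>1 / (1 + \<infinity>) = 0\<close>.\<close>

definition vartheta :: "(real \<Rightarrow> real) \<Rightarrow> real \<Rightarrow> ereal" where
  "vartheta a \<tau> = (SUP (t, s)\<in>{(t, s). \<tau> \<le> s \<and> s \<le> t}. ereal (E a t s))"

definition kappa :: "(real \<Rightarrow> real) \<Rightarrow> (real \<Rightarrow> real) \<Rightarrow> real \<Rightarrow> ereal" where
  "kappa a b \<tau> = (SUP t\<in>{\<tau>..}. ereal (integral {\<tau>..t} (K a b t)))"

end

theory Submission
  imports Defs
begin

text \<open>
  By variation of constants, \<open>\<bar>x(t)\<bar> \<le> E(t,t\<^sub>0) \<bar>x(t\<^sub>0)\<bar> + \<kappa> S\<close>, where \<open>S\<close> bounds \<open>\<bar>x\<bar>\<close> on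
  \<open>[t\<^sub>0 - r, t]\<close>. For \<open>\<kappa> < 1\<close> this bounds \<open>x\<close> by a multiple of the norm of the segment at \<open>t\<^sub>0\<close>, and
  since \<open>E(t,t\<^sub>0)\<close> becomes small, moving \<open>t\<^sub>0\<close> to the right shrinks the bound by a fixed factor again
  and again, so that \<open>x \<rightarrow> 0\<close>. If \<open>E \<le> \<vartheta>\<close>, the first bound has the constant \<open>\<vartheta> / (1 - \<kappa>)\<close>, so
  after a time depending only on \<open>\<eta>\<close> the segment norm is multiplied by at most \<open>\<eta> + \<kappa> \<vartheta> / (1 - \<kappa>)\<close>.
  This is below \<open>1\<close> for small \<open>\<eta>\<close> exactly when \<open>\<kappa> (1 + \<vartheta>) < 1\<close>, and iteration gives exponential
  decay. Global solutions come from Banach's fixed point theorem in an exponentially weighted norm.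
\<close>

section \<open>The sup norm, segments, and an exponentially weighted integral bound\<close>

lemma sup_norm_le:
  assumes "r \<ge> 0" "\<And>s. s \<in> {-r..0} \<Longrightarrow> \<bar>\<phi> s\<bar> \<le> M"
  shows "sup_norm r \<phi> \<le> M"
  unfolding sup_norm_def using assms by (intro cSUP_least) auto

lemma abs_le_sup_norm:
  assumes "continuous_on {-r..0} \<phi>" "s \<in> {-r..0}"
  shows "\<bar>\<phi> s\<bar> \<le> sup_norm r \<phi>"
proof -
  have "compact ((\<lambda>s. \<bar>\<phi> s\<bar>) ` {-r..0})"
    by (intro compact_continuous_image continuous_intros assms) auto
  then show ?thesis
    unfolding sup_norm_def using assms(2)
    by (intro cSUP_upper bounded_imp_bdd_above compact_imp_bounded) auto
qed

lemma segment_in_Cset: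
  assumes "continuous_on {t-r..t} x"
  shows "segment r x t \<in> Cset r"
proof -
  have "continuous_on {-r..0} (\<lambda>s. x (t + s))"
    by (rule continuous_on_compose2[OF assms]) (auto intro!: continuous_intros)
  then have "continuous_on {-r..0} (segment r x t)"
    by (rule continuous_on_eq) (simp add: segment_def)
  then show ?thesis
    by (simp add: mem_Cset_iff segment_def)
qed

lemma sup_norm_segment_le:
  assumes "r \<ge> 0" "\<And>u. u \<in> {t-r..t} \<Longrightarrow> \<bar>x u\<bar> \<le> M"
  shows "sup_norm r (segment r x t) \<le> M"
  using assms by (intro sup_norm_le) (auto simp: segment_def)

lemma sup_norm_segment_diff_le:
  assumes "r \<ge> 0" "\<And>u. u \<in> {t-r..t} \<Longrightarrow> \<bar>x u - y u\<bar> \<le> M"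
  shows "sup_norm r (\<lambda>s. segment r x t s - segment r y t s) \<le> M"
  using assms by (intro sup_norm_le) (auto simp: segment_def)

lemma abs_le_sup_norm_segment:
  assumes "continuous_on {t-r..t} x" "u \<in> {t-r..t}"
  shows "\<bar>x u\<bar> \<le> sup_norm r (segment r x t)"
proof -
  have "continuous_on {-r..0} (segment r x t)"
    using segment_in_Cset[OF assms(1)] by (simp add: mem_Cset_iff)
  from abs_le_sup_norm[OF this, of "u - t"] show ?thesis
    using assms(2) by (auto simp: segment_def)
qed

lemma sup_norm_nonneg:
  assumes "r \<ge> 0" "\<phi> \<in> Cset r"
  shows "sup_norm r \<phi> \<ge> 0"
  using abs_le_sup_norm[of r \<phi> 0] assms by (force simp: mem_Cset_iff)

lemma segment_cong:
  assumes "\<And>u. u \<in> {t-r..t} \<Longrightarrow> x u = y u"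
  shows "segment r x t = segment r y t"
  using assms by (auto simp: segment_def fun_eq_iff)

text \<open>Uniform continuity of \<open>x\<close> on the compact interval \<open>{c-r..d}\<close>
  controls all differences \<open>x (t + u) - x (s + u)\<close> at once, hence their supremum over
  \<open>u\<close>. Combined with the joint continuity of \<open>B\<close>, this makes the delayed
  term continuous in time and therefore integrable.\<close>

lemma continuous_map_segment:
  assumes r: "r \<ge> 0" and x: "continuous_on {c-r..d} x"
  shows "continuous_map (top_of_set {c..d}) (mtopology_of (Cspace r)) (segment r x)"
proof -
  have seg: "segment r x t \<in> Cset r" if "t \<in> {c..d}" for t
    using that by (intro segment_in_Cset continuous_on_subset[OF x]) auto
  have "uniformly_continuous_map (submetric euclidean_metric {c..d}) (Cspace r) (segment r x)"
    unfolding uniformly_continuous_map_def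
  proof (intro conjI allI impI)
    show "segment r x \<in> mspace (submetric euclidean_metric {c..d}) \<rightarrow> mspace (Cspace r)"
      using seg by (auto simp: Cset_def)
    fix e :: real assume e: "e > 0"
    have "uniformly_continuous_on {c-r..d} x"
      using x by (intro compact_uniformly_continuous) auto
    \<comment> \<open>The supremum preserves only non-strict bounds, so \<open>e/2\<close> leaves
      room for the strict inequality below.\<close>
    then obtain \<delta> where \<delta>: "\<delta> > 0"
      "\<And>u v. u \<in> {c-r..d} \<Longrightarrow> v \<in> {c-r..d} \<Longrightarrow> dist v u < \<delta> \<Longrightarrow> dist (x v) (x u) < e/2"
      unfolding uniformly_continuous_on_def using e by (metis half_gt_zero)
    have "mdist (Cspace r) (segment r x t) (segment r x s) < e"
      if "t \<in> {c..d}" "s \<in> {c..d}" "dist t s < \<delta>" for t s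
    proof -
      have "sup_norm r (\<lambda>u. segment r x t u - segment r x s u) \<le> e/2"
      proof (rule sup_norm_le[OF r])
        fix u assume "u \<in> {-r..0}"
        then show "\<bar>segment r x t u - segment r x s u\<bar> \<le> e/2"
          using \<delta>(2)[of "s + u" "t + u"] that by (auto simp: segment_def dist_real_def)
      qed
      then show ?thesis
        using e that seg by (simp add: mdist_Cspace r)
    qed
    then show "\<exists>\<delta>>0. \<forall>s\<in>mspace (submetric euclidean_metric {c..d}).
      \<forall>t\<in>mspace (submetric euclidean_metric {c..d}).
        mdist (submetric euclidean_metric {c..d}) t s < \<delta> \<longrightarrow>
        mdist (Cspace r) (segment r x t) (segment r x s) < e"
      using \<delta>(1) by auto
  qed
  then have "continuous_map (mtopology_of (submetric euclidean_metric {c..d})) (mtopology_of (Cspace r)) (segment r x)"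
    by (rule uniformly_continuous_imp_continuous_map)
  then show ?thesis
    by (simp add: mtopology_of_submetric)
qed

text \<open>Integrating an exponential of rate \<open>l\<close> gains the factor
  \<open>1 / l\<close>. Uniqueness and the contraction estimate use it to beat a Lipschitz constant
  by a large \<open>l\<close>; the invariance of the Gronwall bound uses it together with the exact
  term \<open>- 1\<close>.\<close>

lemma abs_integral_le_exp:
  fixes f :: "real \<Rightarrow> real"
  assumes "f integrable_on {c..t}" "c \<le> t" "l > 0"
    and "\<And>s. s \<in> {c..t} \<Longrightarrow> \<bar>f s\<bar> \<le> C * exp (l * (s - c))"
  shows "\<bar>integral {c..t} f\<bar> \<le> C / l * (exp (l * (t - c)) - 1)"
proof -
  have "((\<lambda>s. C * exp (l * (s - c))) has_integral
      C / l * exp (l * (t - c)) - C / l * exp (l * (c - c))) {c..t}"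
    using assms(2,3)
    by (intro fundamental_theorem_of_calculus)
      (auto intro!: derivative_eq_intros simp: has_real_derivative_iff_has_vector_derivative[symmetric])
  then show ?thesis
    using integral_norm_bound_integral[OF assms(1) _, of "\<lambda>s. C * exp (l * (s - c))"] assms(4)
    by (auto simp: has_integral_iff algebra_simps)
qed

section \<open>The kernels \<open>E\<close> and \<open>K\<close> and the suprema
  \<open>kappa\<close> and \<open>vartheta\<close>\<close>

lemma continuous_on_E:
  assumes "continuous_on UNIV a"
  shows "continuous_on {c..t} (E a t)"
proof -
  have "a integrable_on {c..t}"
    by (intro integrable_continuous_real continuous_on_subset[OF assms]) auto
  then have "continuous_on {c..t} (\<lambda>s. exp (- integral {s..t} a))"
    by (intro continuous_intros indefinite_integral_continuous_1')
  then show ?thesis by (simp add: E_def[abs_def])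
qed

lemma continuous_on_K:
  assumes "continuous_on UNIV a" "continuous_on UNIV b"
  shows "continuous_on {c..t} (K a b t)"
  unfolding K_def[abs_def]
  by (intro continuous_intros continuous_on_E assms continuous_on_subset[OF assms(2)]) auto

lemma E_pos: "E a t s > 0"
  by (simp add: E_def)

lemma E_self [simp]: "E a t t = 1"
  by (simp add: E_def)

text \<open>The lag \<open>T\<close> does not depend on \<open>s\<close> because the divergence of
  the integral of \<open>a\<close> is uniform. This is what allows the decay estimate to be
  restarted at ever later times with the same \<open>T\<close>.\<close>

lemma E_uniform_decay:
  assumes "\<And>N. \<forall>\<^sub>F t in at_top. \<forall>s. integral {s..s + t} a \<ge> N" "\<eta> > 0"
  obtains T where "T > 0" "\<And>s t. t \<ge> s + T \<Longrightarrow> E a t s \<le> \<eta>"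
proof -
  obtain T0 where T0: "\<And>t s. t \<ge> T0 \<Longrightarrow> integral {s..s + t} a \<ge> - ln \<eta>"
    using assms(1)[of "- ln \<eta>"] unfolding eventually_at_top_linorder by blast
  have "E a t s \<le> \<eta>" if "t \<ge> s + max 1 T0" for s t
  proof -
    have "t - s \<ge> T0" using that by linarith
    then have "- integral {s..t} a \<le> ln \<eta>"
      using T0[of "t - s" s] by simp
    then have "exp (- integral {s..t} a) \<le> exp (ln \<eta>)"
      by (simp only: exp_le_cancel_iff)
    then show ?thesis
      using assms(2) by (simp add: E_def)
  qed
  with that[of "max 1 T0"] show ?thesis by auto
qed

text \<open>Beyond a lag \<open>T\<close> the kernel is at most 1, and on \<open>{s..s+T}\<close> it
  is bounded by compactness. The constant may depend on \<open>s\<close>, so no finiteness of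
  \<open>vartheta\<close> is involved.\<close>

lemma E_bounded:
  assumes "continuous_on UNIV a" "\<And>N. \<forall>\<^sub>F t in at_top. \<forall>s. integral {s..s + t} a \<ge> N"
  obtains C where "C \<ge> 1" "\<And>t. t \<ge> s \<Longrightarrow> E a t s \<le> C"
proof -
  obtain T where T: "T > 0" "\<And>u t. t \<ge> u + T \<Longrightarrow> E a t u \<le> 1"
    using E_uniform_decay[of a 1] assms(2) by auto
  have "a integrable_on {s..s+T}"
    by (intro integrable_continuous_real continuous_on_subset[OF assms(1)]) auto
  then have "compact ((\<lambda>t. E a t s) ` {s..s+T})"
    unfolding E_def
    by (intro compact_continuous_image continuous_intros indefinite_integral_continuous_1) auto
  then obtain C where C: "\<And>t. t \<in> {s..s+T} \<Longrightarrow> E a t s \<le> C"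
    using compact_imp_bounded[of "(\<lambda>t. E a t s) ` {s..s+T}"] unfolding bounded_iff by (fastforce simp: E_pos less_imp_le)
  have "E a t s \<le> max 1 C" if "t \<ge> s" for t
    using C[of t] T(2)[of s t] that by (cases "t \<le> s + T") auto
  with that[of "max 1 C"] show ?thesis by auto
qed

lemma kappa_finite:
  assumes "kappa a b \<tau> < \<infinity>"
  obtains k where "kappa a b \<tau> = ereal k" "k \<ge> 0" "\<And>t. t \<ge> \<tau> \<Longrightarrow> integral {\<tau>..t} (K a b t) \<le> k"
proof -
  have up: "ereal (integral {\<tau>..t} (K a b t)) \<le> kappa a b \<tau>" if "t \<ge> \<tau>" for t
    unfolding kappa_def using that by (intro SUP_upper) auto
  have "0 \<le> kappa a b \<tau>" using up[of \<tau>] by (simp add: zero_ereal_def)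
  with assms obtain k where k: "kappa a b \<tau> = ereal k" by (cases "kappa a b \<tau>") auto
  with that[of k] up \<open>0 \<le> kappa a b \<tau>\<close> show ?thesis by auto
qed

lemma kappa_less_1:
  assumes "kappa a b \<tau> < 1"
  obtains k where "k \<ge> 0" "k < 1" "\<And>t. t \<ge> \<tau> \<Longrightarrow> integral {\<tau>..t} (K a b t) \<le> k"
proof -
  have "kappa a b \<tau> < \<infinity>" using assms by auto
  then show ?thesis
    using kappa_finite[of a b \<tau>] assms that by (metis ereal_less(3) less_ereal.simps(1) one_ereal_def)
qed

lemma vartheta_upper:
  assumes "\<tau> \<le> s" "s \<le> t"
  shows "ereal (E a t s) \<le> vartheta a \<tau>"
  unfolding vartheta_def using assms by (intro SUP_upper2[of "(t, s)"]) auto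

text \<open>If \<open>vartheta\<close> were infinite, the right-hand side would be 0, which a
  nonnegative \<open>kappa\<close> cannot undercut. So both suprema are real numbers, and the
  hypothesis turns into an inequality between reals. The bound \<open>\<theta> \<ge> 1\<close> comes
  from \<open>E a \<tau> \<tau> = 1\<close>.\<close>

lemma kappa_vartheta_finite:
  assumes "kappa a b \<tau> < 1 / (1 + vartheta a \<tau>)"
  obtains k \<theta> where "k \<ge> 0" "\<theta> \<ge> 1" "k * (1 + \<theta>) < 1"
    "\<And>t. t \<ge> \<tau> \<Longrightarrow> integral {\<tau>..t} (K a b t) \<le> k"
    "\<And>s t. \<tau> \<le> s \<Longrightarrow> s \<le> t \<Longrightarrow> E a t s \<le> \<theta>"
proof -
  have "kappa a b \<tau> < \<infinity>" using assms by auto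
  obtain k where k: "kappa a b \<tau> = ereal k" "k \<ge> 0"
    "\<And>t. t \<ge> \<tau> \<Longrightarrow> integral {\<tau>..t} (K a b t) \<le> k"
    using kappa_finite[OF \<open>kappa a b \<tau> < \<infinity>\<close>] by blast
  have one: "1 \<le> vartheta a \<tau>"
    using vartheta_upper[of \<tau> \<tau> \<tau> a] by (simp add: one_ereal_def)
  show ?thesis
  proof (cases "vartheta a \<tau>")
    case (real \<theta>)
    have \<theta>: "\<theta> \<ge> 1" using one real by simp
    have "1 / (1 + vartheta a \<tau>) = ereal (1 / (1 + \<theta>))"
      using \<theta> by (simp add: real one_ereal_def)
    then have "k < 1 / (1 + \<theta>)" using assms k(1) by simp
    then have "k * (1 + \<theta>) < 1" using \<theta> by (simp add: less_divide_eq)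
    moreover have "E a t s \<le> \<theta>" if "\<tau> \<le> s" "s \<le> t" for s t
      using vartheta_upper[OF that, of a] real by simp
    ultimately show ?thesis using that k \<theta> by blast
  next
    case PInf
    then show ?thesis using assms k by simp
  qed (use one in simp)
qed

section \<open>The delay equation and its right-hand side\<close>

locale delay_equation =
  fixes r :: real and a b :: "real \<Rightarrow> real" and B :: "real \<Rightarrow> (real \<Rightarrow> real) \<Rightarrow> real"
  assumes r_nonneg: "r \<ge> 0"
    and a_cont: "continuous_on UNIV a"
    and B_cont: "continuous_map (prod_topology euclidean (mtopology_of (Cspace r))) euclidean
                   (\<lambda>(t, \<phi>). B t \<phi>)"
    and B_lipschitz: "\<And>c d R. R > 0 \<Longrightarrow>
       \<exists>L>0. \<forall>t\<in>{c..d}. \<forall>\<phi>\<in>Cset r. \<forall>\<phi>'\<in>Cset r. sup_norm r \<phi> \<le> R \<longrightarrow> sup_norm r \<phi>' \<le> R \<longrightarrow>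
         \<bar>B t \<phi> - B t \<phi>'\<bar> \<le> L * sup_norm r (\<lambda>s. \<phi> s - \<phi>' s)"
    and b_cont: "continuous_on UNIV b"
    and b_nonneg: "\<And>t. b t \<ge> 0"
    and B_bound: "\<And>t \<phi>. \<phi> \<in> Cset r \<Longrightarrow> \<bar>B t \<phi>\<bar> \<le> b t * sup_norm r \<phi>"
begin

definition rhs :: "(real \<Rightarrow> real) \<Rightarrow> real \<Rightarrow> real" where
  "rhs x t = - a t * x t + B t (segment r x t)"

lemma rhs_cong:
  assumes "\<And>u. u \<in> {t-r..t} \<Longrightarrow> x u = y u"
  shows "rhs x t = rhs y t"
  using segment_cong[OF assms, of t r] assms[of t] r_nonneg by (simp add: rhs_def)

lemma continuous_on_B_segment:
  assumes "continuous_on {c-r..d} x"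
  shows "continuous_on {c..d} (\<lambda>t. B t (segment r x t))"
proof -
  have "continuous_map (top_of_set {c..d}) (prod_topology euclidean (mtopology_of (Cspace r)))
      (\<lambda>t. (t, segment r x t))"
    by (intro continuous_map_pairedI continuous_map_segment r_nonneg assms
        continuous_map_from_subtopology) auto
  from continuous_map_compose[OF this B_cont] show ?thesis
    by (simp add: o_def)
qed

lemma continuous_on_rhs:
  assumes "continuous_on {c-r..d} x"
  shows "continuous_on {c..d} (rhs x)"
proof -
  have "continuous_on {c..d} x"
    by (rule continuous_on_subset[OF assms]) (use r_nonneg in auto)
  then have "continuous_on {c..d} (\<lambda>t. - a t * x t + B t (segment r x t))"
    by (intro continuous_intros continuous_on_B_segment assms continuous_on_subset[OF a_cont]) auto
  then show ?thesis
    by (simp add: rhs_def[abs_def])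
qed

lemma abs_B_segment_le:
  assumes "continuous_on {t-r..t} x" "\<And>u. u \<in> {t-r..t} \<Longrightarrow> \<bar>x u\<bar> \<le> M"
  shows "\<bar>B t (segment r x t)\<bar> \<le> b t * M"
proof -
  have "sup_norm r (segment r x t) \<le> M"
    by (rule sup_norm_segment_le[OF r_nonneg assms(2)])
  then show ?thesis
    using B_bound[OF segment_in_Cset[OF assms(1)], of t] mult_left_mono[OF _ b_nonneg[of t]]
    by fastforce
qed

lemma abs_rhs_le:
  assumes "continuous_on {t-r..t} x" "\<And>u. u \<in> {t-r..t} \<Longrightarrow> \<bar>x u\<bar> \<le> M"
  shows "\<bar>rhs x t\<bar> \<le> (\<bar>a t\<bar> + b t) * M"
proof -
  have "\<bar>- a t * x t\<bar> \<le> \<bar>a t\<bar> * M"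
    using assms(2)[of t] r_nonneg by (simp add: abs_mult mult_left_mono)
  then show ?thesis
    using abs_B_segment_le[OF assms] unfolding rhs_def by (simp add: algebra_simps)
qed

text \<open>The difference enters through an arbitrary bound \<open>M\<close> on the delay window
  instead of a sup norm, so that exponentially growing bounds can be inserted directly. The constant
  adds a bound of \<open>a\<close> on \<open>{c..d}\<close> to the local Lipschitz constant of
  \<open>B\<close>.\<close>

lemma rhs_lipschitz:
  assumes "R > 0"
  obtains L where "L > 0"
    "\<And>t x y M. t \<in> {c..d} \<Longrightarrow> continuous_on {t-r..t} x \<Longrightarrow> continuous_on {t-r..t} y \<Longrightarrow>
      (\<And>u. u \<in> {t-r..t} \<Longrightarrow> \<bar>x u\<bar> \<le> R) \<Longrightarrow> (\<And>u. u \<in> {t-r..t} \<Longrightarrow> \<bar>y u\<bar> \<le> R) \<Longrightarrow>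
      (\<And>u. u \<in> {t-r..t} \<Longrightarrow> \<bar>x u - y u\<bar> \<le> M) \<Longrightarrow> \<bar>rhs x t - rhs y t\<bar> \<le> L * M"
proof -
  obtain L where L: "L > 0" "\<And>t \<phi> \<phi>'. t \<in> {c..d} \<Longrightarrow> \<phi> \<in> Cset r \<Longrightarrow> \<phi>' \<in> Cset r \<Longrightarrow>
      sup_norm r \<phi> \<le> R \<Longrightarrow> sup_norm r \<phi>' \<le> R \<Longrightarrow>
      \<bar>B t \<phi> - B t \<phi>'\<bar> \<le> L * sup_norm r (\<lambda>s. \<phi> s - \<phi>' s)"
    using B_lipschitz[OF assms, of c d] by blast
  have "compact (a ` {c..d})"
    by (intro compact_continuous_image continuous_on_subset[OF a_cont]) auto
  then obtain A where A: "A > 0" "\<And>t. t \<in> {c..d} \<Longrightarrow> \<bar>a t\<bar> \<le> A"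
    using compact_imp_bounded[of "a ` {c..d}"] unfolding bounded_pos by auto
  have "\<bar>rhs x t - rhs y t\<bar> \<le> (A + L) * M"
    if t: "t \<in> {c..d}" and x: "continuous_on {t-r..t} x" and y: "continuous_on {t-r..t} y"
      and xR: "\<And>u. u \<in> {t-r..t} \<Longrightarrow> \<bar>x u\<bar> \<le> R" and yR: "\<And>u. u \<in> {t-r..t} \<Longrightarrow> \<bar>y u\<bar> \<le> R"
      and M: "\<And>u. u \<in> {t-r..t} \<Longrightarrow> \<bar>x u - y u\<bar> \<le> M" for t x y M
  proof -
    have "\<bar>B t (segment r x t) - B t (segment r y t)\<bar>
        \<le> L * sup_norm r (\<lambda>s. segment r x t s - segment r y t s)"
      by (intro L(2) t segment_in_Cset x y sup_norm_segment_le r_nonneg xR yR)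
    also have "\<dots> \<le> L * M"
      using L(1) by (intro mult_left_mono sup_norm_segment_diff_le r_nonneg M) auto
    finally have "\<bar>B t (segment r x t) - B t (segment r y t)\<bar> \<le> L * M" .
    moreover have "\<bar>a t * (x t - y t)\<bar> \<le> A * M"
      unfolding abs_mult using A M[of t] r_nonneg t by (intro mult_mono) auto
    ultimately show ?thesis
      unfolding rhs_def by (simp add: algebra_simps)
  qed
  with that[of "A + L"] A L show ?thesis by auto
qed

section \<open>Uniqueness and existence on bounded intervals\<close>

lemma solution_unique_on:
  assumes x: "continuous_on {\<tau>-r..T} x" and y: "continuous_on {\<tau>-r..T} y"
    and init: "\<And>s. s \<in> {\<tau>-r..\<tau>} \<Longrightarrow> x s = y s"
    and xi: "\<And>t. t \<in> {\<tau>..T} \<Longrightarrow> x t = x \<tau> + integral {\<tau>..t} (rhs x)"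
    and yi: "\<And>t. t \<in> {\<tau>..T} \<Longrightarrow> y t = y \<tau> + integral {\<tau>..t} (rhs y)"
    and t: "t \<in> {\<tau>-r..T}"
  shows "x t = y t"
proof (cases "t \<le> \<tau>")
  case True
  then show ?thesis using init t by auto
next
  case False
  then have T: "\<tau> \<le> T" using t by auto
  \<comment> \<open>One radius \<open>R\<close> for both solutions on the whole interval, so that a
    single local Lipschitz constant serves throughout.\<close>
  have "compact (x ` {\<tau>-r..T} \<union> y ` {\<tau>-r..T})"
    by (intro compact_Un compact_continuous_image x y) auto
  then obtain R where R: "R > 0" "\<And>u. u \<in> {\<tau>-r..T} \<Longrightarrow> \<bar>x u\<bar> \<le> R" "\<And>u. u \<in> {\<tau>-r..T} \<Longrightarrow> \<bar>y u\<bar> \<le> R"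
    using compact_imp_bounded[of "x ` {\<tau>-r..T} \<union> y ` {\<tau>-r..T}"]
    unfolding bounded_pos ball_Un by auto
  obtain L where L: "L > 0"
    "\<And>t x y M. t \<in> {\<tau>..T} \<Longrightarrow> continuous_on {t-r..t} x \<Longrightarrow> continuous_on {t-r..t} y \<Longrightarrow>
      (\<And>u. u \<in> {t-r..t} \<Longrightarrow> \<bar>x u\<bar> \<le> R) \<Longrightarrow> (\<And>u. u \<in> {t-r..t} \<Longrightarrow> \<bar>y u\<bar> \<le> R) \<Longrightarrow>
      (\<And>u. u \<in> {t-r..t} \<Longrightarrow> \<bar>x u - y u\<bar> \<le> M) \<Longrightarrow> \<bar>rhs x t - rhs y t\<bar> \<le> L * M"
    using rhs_lipschitz[OF R(1), of \<tau> T] by blast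
  \<comment> \<open>At the maximum \<open>p\<close> of the weighted difference, the integral equation gives \<open>m p \<le> m p / 2\<close>.\<close>
  define l where "l = 2 * L"
  define m where "m s = exp (- l * (s - \<tau>)) * \<bar>x s - y s\<bar>" for s
  have "continuous_on {\<tau>-r..T} m"
    unfolding m_def[abs_def] by (intro continuous_intros x y)
  moreover have "compact {\<tau>-r..T}" "{\<tau>-r..T} \<noteq> {}" using T r_nonneg by auto
  ultimately obtain p where p: "p \<in> {\<tau>-r..T}" "\<And>s. s \<in> {\<tau>-r..T} \<Longrightarrow> m s \<le> m p"
    using continuous_attains_sup by meson
  have mp: "m p \<ge> 0" by (simp add: m_def)
  have diff: "\<bar>x s - y s\<bar> \<le> m p * exp (l * (s - \<tau>))" if "s \<in> {\<tau>-r..T}" for s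
    using mult_right_mono[OF p(2)[OF that], of "exp (l * (s - \<tau>))"]
    by (simp add: m_def algebra_simps flip: exp_add)
  have "m p \<le> 0"
  proof (cases "p \<le> \<tau>")
    case True
    then show ?thesis using init[of p] p(1) by (simp add: m_def)
  next
    case False
    then have p': "p \<in> {\<tau>..T}" using p by auto
    have cont: "continuous_on {\<tau>..p} (rhs x)" "continuous_on {\<tau>..p} (rhs y)"
      using p' by (auto intro!: continuous_on_rhs continuous_on_subset[OF x] continuous_on_subset[OF y])
    have "x p - y p = integral {\<tau>..p} (\<lambda>s. rhs x s - rhs y s)"
      using xi[OF p'] yi[OF p'] init[of \<tau>] r_nonneg cont
      by (simp add: integral_diff integrable_continuous_real)
    moreover have "\<bar>integral {\<tau>..p} (\<lambda>s. rhs x s - rhs y s)\<bar> \<le> (L * m p) / l * (exp (l * (p - \<tau>)) - 1)"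
    proof (rule abs_integral_le_exp)
      show "(\<lambda>s. rhs x s - rhs y s) integrable_on {\<tau>..p}"
        by (intro integrable_continuous_real continuous_intros cont)
      fix s assume s: "s \<in> {\<tau>..p}"
      have "\<bar>rhs x s - rhs y s\<bar> \<le> L * (m p * exp (l * (s - \<tau>)))"
      proof (rule L(2))
        \<comment> \<open>The bound must hold on the whole window reaching back to
          \<open>s - r\<close>. The exponential is increasing, so its value at the right end
          \<open>s\<close> dominates; \<open>diff\<close> also covers points before
          \<open>\<tau>\<close>.\<close>
        fix u assume u: "u \<in> {s - r..s}"
        then have "m p * exp (l * (u - \<tau>)) \<le> m p * exp (l * (s - \<tau>))"
          using L(1) by (intro mult_left_mono mp) (auto simp: l_def)
        then show "\<bar>x u - y u\<bar> \<le> m p * exp (l * (s - \<tau>))"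
          using diff[of u] u s p by auto
      qed (use s p R in \<open>auto intro!: continuous_on_subset[OF x] continuous_on_subset[OF y]\<close>)
      then show "\<bar>rhs x s - rhs y s\<bar> \<le> (L * m p) * exp (l * (s - \<tau>))" by simp
    qed (use False L in \<open>auto simp: l_def\<close>)
    ultimately have "\<bar>x p - y p\<bar> \<le> m p / 2 * (exp (l * (p - \<tau>)) - 1)"
      using L(1) by (simp add: l_def)
    also have "\<dots> \<le> m p / 2 * exp (l * (p - \<tau>))"
      using mp by (intro mult_left_mono) auto
    finally have le: "\<bar>x p - y p\<bar> \<le> m p / 2 * exp (l * (p - \<tau>))" .
    have "m p = exp (- l * (p - \<tau>)) * \<bar>x p - y p\<bar>"
      by (simp only: m_def)
    also have "\<dots> \<le> exp (- l * (p - \<tau>)) * (m p / 2 * exp (l * (p - \<tau>)))"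
      by (intro mult_left_mono le) auto
    also have "\<dots> = m p / 2"
      by (simp flip: exp_add)
    finally show ?thesis by simp
  qed
  then show ?thesis using diff[OF t] mult_right_mono[of "m p" 0 "exp (l * (t - \<tau>))"] by simp
qed

lemma solution_exists_on:
  assumes \<phi>: "\<phi> \<in> Cset r" and T: "\<tau> \<le> T"
  shows "\<exists>x. continuous_on {\<tau>-r..T} x \<and> (\<forall>s\<in>{-r..0}. x (\<tau> + s) = \<phi> s) \<and>
    (\<forall>t\<in>{\<tau>..T}. x t = x \<tau> + integral {\<tau>..t} (rhs x))"
proof -
  have \<phi>_cont: "continuous_on {-r..0} \<phi>" using \<phi> by (simp add: mem_Cset_iff)
  define N where "N = sup_norm r \<phi>"
  have N: "N \<ge> 0" using sup_norm_nonneg[OF r_nonneg \<phi>] by (simp add: N_def)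
  have "compact ((\<lambda>t. \<bar>a t\<bar> + b t) ` {\<tau>..T})"
    by (intro compact_continuous_image continuous_intros continuous_on_subset[OF a_cont]
        continuous_on_subset[OF b_cont]) auto
  then obtain A where A: "A > 0" "\<And>t. t \<in> {\<tau>..T} \<Longrightarrow> \<bar>a t\<bar> + b t \<le> A"
    using compact_imp_bounded[of "(\<lambda>t. \<bar>a t\<bar> + b t) ` {\<tau>..T}"] b_nonneg unfolding bounded_pos by force
  \<comment> \<open>Substituting \<open>y = w z\<close> with an exponential weight \<open>w\<close> makes the integral operator a contraction on
    all of \<open>[\<tau>, T]\<close>. The Lipschitz constant is only local; the set of \<open>y\<close> below the Gronwall bound
    \<open>\<rho>\<close> is invariant and fixes the radius \<open>R\<close> before the weight is chosen. Paths are extended to the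
    whole line by freezing them outside \<open>[\<tau> - r, T]\<close>.\<close>
  define c where "c t = max 0 (min t T - \<tau>)" for t
  have c: "0 \<le> c t" "c t \<le> T - \<tau>" for t using T by (auto simp: c_def)
  have c_mono: "c u \<le> c t" if "u \<le> t" for u t using that by (auto simp: c_def)
  have c_eq: "c t = t - \<tau>" if "t \<in> {\<tau>..T}" for t using that by (auto simp: c_def)
  have c_cont: "continuous_on UNIV c" unfolding c_def[abs_def] by (intro continuous_intros)
  define \<rho> where "\<rho> t = N * exp (A * c t)" for t
  \<comment> \<open>The summand 1 keeps \<open>R\<close> positive when the initial function is
    zero.\<close>
  define R where "R = N * exp (A * (T - \<tau>)) + 1"
  have R: "R > 0" unfolding R_def using N by (intro add_nonneg_pos mult_nonneg_nonneg) auto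
  have \<rho>R: "\<rho> t \<le> R" for t
  proof -
    have "\<rho> t \<le> N * exp (A * (T - \<tau>))"
      unfolding \<rho>_def using c(2)[of t] A N by (intro mult_left_mono) auto
    then show ?thesis by (simp add: R_def)
  qed
  have \<rho>_mono: "\<rho> u \<le> \<rho> t" if "u \<le> t" for u t
    unfolding \<rho>_def using c_mono[OF that] A N by (intro mult_left_mono) auto
  obtain L where L: "L > 0"
    "\<And>t x y M. t \<in> {\<tau>..T} \<Longrightarrow> continuous_on {t-r..t} x \<Longrightarrow> continuous_on {t-r..t} y \<Longrightarrow>
      (\<And>u. u \<in> {t-r..t} \<Longrightarrow> \<bar>x u\<bar> \<le> R) \<Longrightarrow> (\<And>u. u \<in> {t-r..t} \<Longrightarrow> \<bar>y u\<bar> \<le> R) \<Longrightarrow>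
      (\<And>u. u \<in> {t-r..t} \<Longrightarrow> \<bar>x u - y u\<bar> \<le> M) \<Longrightarrow> \<bar>rhs x t - rhs y t\<bar> \<le> L * M"
    using rhs_lipschitz[OF R, of \<tau> T] by blast
  define l where "l = 2 * L"
  have l: "l > 0" using L(1) by (simp add: l_def)
  define w where "w t = exp (l * c t)" for t
  have w: "w t > 0" for t by (simp add: w_def)
  have w_mono: "w u \<le> w t" if "u \<le> t" for u t
    using c_mono[OF that] l by (simp add: w_def)
  have w1: "1 \<le> w t" for t using c(1)[of t] l by (simp add: w_def)
  have w_cont: "continuous_on X w" for X
    unfolding w_def[abs_def] by (intro continuous_intros continuous_on_subset[OF c_cont]) auto
  define Y where "Y z = (\<lambda>t. w t * apply_bcontfun z t)" for z
  have Y_cont: "continuous_on X (Y z)" for X z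
    unfolding Y_def by (intro continuous_intros w_cont) auto
  \<comment> \<open>The integral operator on the whole line. Clamping the argument keeps it in
    \<open>{-r..0}\<close> and yields \<open>\<phi> 0\<close> from \<open>\<tau>\<close> on; the
    integral vanishes before \<open>\<tau>\<close> because \<open>c\<close> does.\<close>
  define P where "P y t = \<phi> (max (-r) (min 0 (t - \<tau>))) + integral {\<tau>..\<tau> + c t} (rhs y)" for y t
  define S where "S = {z. \<forall>t. \<bar>Y z t\<bar> \<le> \<rho> t}"
  have S_D: "\<bar>Y z t\<bar> \<le> \<rho> t" if "z \<in> S" for z t
    using that by (simp add: S_def)
  have rhsY_int: "rhs (Y z) integrable_on {\<tau>..u}" for z u
    by (intro integrable_continuous_real continuous_on_rhs Y_cont)
  \<comment> \<open>The initial part contributes at most \<open>N\<close> and the integral at most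
    \<open>N * (exp (A * c t) - 1)\<close>; the sum is exactly \<open>\<rho> t\<close>.\<close>
  have P_bound: "\<bar>P (Y z) t\<bar> \<le> \<rho> t" if z: "z \<in> S" for z t
  proof -
    have "\<bar>\<phi> (max (-r) (min 0 (t - \<tau>)))\<bar> \<le> N"
      unfolding N_def using r_nonneg by (intro abs_le_sup_norm[OF \<phi>_cont]) auto
    moreover have "\<bar>integral {\<tau>..\<tau> + c t} (rhs (Y z))\<bar> \<le> (A * N) / A * (exp (A * (\<tau> + c t - \<tau>)) - 1)"
    proof (rule abs_integral_le_exp)
      fix s assume "s \<in> {\<tau>..\<tau> + c t}"
      then have s: "s \<in> {\<tau>..T}" using c(2)[of t] by auto
      have "\<bar>rhs (Y z) s\<bar> \<le> (\<bar>a s\<bar> + b s) * \<rho> s"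
      proof (rule abs_rhs_le[OF Y_cont])
        show "\<bar>Y z u\<bar> \<le> \<rho> s" if "u \<in> {s-r..s}" for u
          using S_D[OF z, of u] \<rho>_mono[of u s] that by auto
      qed
      also have "\<dots> \<le> A * \<rho> s"
        using A(2)[OF s] N by (intro mult_right_mono) (auto simp: \<rho>_def)
      finally show "\<bar>rhs (Y z) s\<bar> \<le> A * N * exp (A * (s - \<tau>))"
        by (simp add: \<rho>_def c_eq[OF s])
    qed (use A c in \<open>auto intro: rhsY_int\<close>)
    ultimately show ?thesis
      using A(1) by (simp add: P_def \<rho>_def algebra_simps)
  qed
  have P_cont: "continuous_on UNIV (P (Y z))" for z
  proof -
    have "continuous_on UNIV (\<lambda>t. \<phi> (max (-r) (min 0 (t - \<tau>))))"
      using r_nonneg by (intro continuous_on_compose2[OF \<phi>_cont] continuous_intros) auto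
    moreover have "continuous_on UNIV (\<lambda>t. integral {\<tau>..\<tau> + c t} (rhs (Y z)))"
      by (rule continuous_on_compose2[OF indefinite_integral_continuous_1[OF rhsY_int[of z T]]])
        (use c in \<open>auto intro!: continuous_intros c_cont simp: algebra_simps\<close>)
    ultimately show ?thesis
      unfolding P_def[abs_def] by (intro continuous_intros)
  qed
  \<comment> \<open>\<open>Bcontfun\<close> yields the intended function only if its argument is
    bounded and continuous. Boundedness is established for \<open>z \<in> S\<close> only, hence the
    restriction in the next fact.\<close>
  define Q where "Q z = Bcontfun (\<lambda>t. P (Y z) t / w t)" for z
  have Q: "apply_bcontfun (Q z) t = P (Y z) t / w t" if z: "z \<in> S" for z t
  proof -
    have "\<bar>P (Y z) t / w t\<bar> \<le> R" for t
    proof -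
      have "\<bar>P (Y z) t\<bar> \<le> R * 1" using P_bound[OF z, of t] \<rho>R[of t] by simp
      also have "\<dots> \<le> R * w t" using w1[of t] R by (intro mult_left_mono) auto
      finally show ?thesis using w[of t] by (simp add: divide_le_eq)
    qed
    then have "bounded (range (\<lambda>t. P (Y z) t / w t))"
      by (intro boundedI[of _ R]) auto
    moreover have "continuous_on UNIV (\<lambda>t. P (Y z) t / w t)"
      using w by (intro continuous_intros P_cont w_cont) (auto simp: less_imp_neq[symmetric])
    ultimately show ?thesis
      unfolding Q_def by (subst Bcontfun_inverse) (auto simp: bcontfun_def)
  qed
  have YQ: "Y (Q z) t = P (Y z) t" if "z \<in> S" for z t
    using w[of t] Q[OF that, of t] by (simp add: Y_def)
  have "closed S"
  proof -
    \<comment> \<open>Evaluation at a point is continuous for uniform convergence, so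
      \<open>S\<close> is an intersection of closed sets.\<close>
    have *: "continuous_on UNIV (\<lambda>z :: real \<Rightarrow>\<^sub>C real. apply_bcontfun z t)" for t
    proof -
      have "((\<lambda>z. apply_bcontfun z t) \<longlongrightarrow> apply_bcontfun z0 t) (at z0)" for z0 :: "real \<Rightarrow>\<^sub>C real"
        using tendsto_bcontfun_uniform_limit[OF tendsto_ident_at, of z0 UNIV]
        by (rule tendsto_uniform_limitI) auto
      then show ?thesis by (simp add: continuous_on_def)
    qed
    show ?thesis
      unfolding S_def Y_def by (intro closed_Collect_all closed_Collect_le continuous_intros *)
  qed
  then have "complete S" by (simp add: complete_eq_closed)
  moreover have "const_bcontfun 0 \<in> S"
    using N by (simp add: S_def Y_def const_bcontfun.rep_eq \<rho>_def)
  moreover have "Q ` S \<subseteq> S"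
    using YQ P_bound by (auto simp: S_def)
  \<comment> \<open>The right-hand sides differ by at most
    \<open>L * dist z1 z2 * exp (l * (s - \<tau>))\<close>. Integration gains \<open>1 / l\<close>,
    division by \<open>w t\<close> removes the exponential, and \<open>L / l = 1/2\<close>
    remains.\<close>
  moreover have "dist (Q z1) (Q z2) \<le> 1/2 * dist z1 z2" if z: "z1 \<in> S" "z2 \<in> S" for z1 z2
  proof (rule dist_bound)
    fix t
    let ?D = "dist z1 z2"
    have "\<bar>integral {\<tau>..\<tau> + c t} (\<lambda>s. rhs (Y z1) s - rhs (Y z2) s)\<bar>
        \<le> (L * ?D) / l * (exp (l * (\<tau> + c t - \<tau>)) - 1)"
    proof (rule abs_integral_le_exp)
      show "(\<lambda>s. rhs (Y z1) s - rhs (Y z2) s) integrable_on {\<tau>..\<tau> + c t}"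
        by (intro integrable_diff rhsY_int)
      fix s assume "s \<in> {\<tau>..\<tau> + c t}"
      then have s: "s \<in> {\<tau>..T}" using c(2)[of t] by auto
      have "\<bar>rhs (Y z1) s - rhs (Y z2) s\<bar> \<le> L * (w s * ?D)"
      proof (rule L(2)[OF s Y_cont Y_cont])
        fix u assume u: "u \<in> {s-r..s}"
        show "\<bar>Y z1 u\<bar> \<le> R" "\<bar>Y z2 u\<bar> \<le> R"
          using S_D[OF z(1), of u] S_D[OF z(2), of u] \<rho>R[of u] by auto
        have "\<bar>Y z1 u - Y z2 u\<bar> = w u * dist (apply_bcontfun z1 u) (apply_bcontfun z2 u)"
          using w[of u] by (simp add: Y_def dist_real_def abs_mult flip: right_diff_distrib)
        also have "\<dots> \<le> w s * ?D"
          using u w_mono[of u s] w[of s] by (intro mult_mono dist_bounded) auto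
        finally show "\<bar>Y z1 u - Y z2 u\<bar> \<le> w s * ?D" .
      qed
      then show "\<bar>rhs (Y z1) s - rhs (Y z2) s\<bar> \<le> L * ?D * exp (l * (s - \<tau>))"
        by (simp add: w_def c_eq[OF s] mult_ac)
    qed (use l c in auto)
    then have "\<bar>P (Y z1) t - P (Y z2) t\<bar> \<le> ?D / 2 * (w t - 1)"
      using L(1) rhsY_int by (simp add: P_def integral_diff l_def w_def)
    also have "\<dots> \<le> ?D / 2 * w t" by (intro mult_left_mono) auto
    finally show "dist (apply_bcontfun (Q z1) t) (apply_bcontfun (Q z2) t) \<le> 1/2 * ?D"
      using w[of t] by (simp add: Q z dist_real_def divide_le_eq flip: diff_divide_distrib)
  qed
  ultimately have "\<exists>!z\<in>S. Q z = z"
    by (intro Banach_fix[of S "1/2" Q]) auto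
  then obtain z where z: "z \<in> S" "Q z = z" by blast
  have fp: "Y z t = P (Y z) t" for t using YQ[OF z(1), of t] z(2) by simp
  show ?thesis
  proof (intro exI[of _ "Y z"] conjI ballI)
    show "continuous_on {\<tau>-r..T} (Y z)" by (rule Y_cont)
    show "Y z (\<tau> + s) = \<phi> s" if "s \<in> {-r..0}" for s
    proof -
      have "c (\<tau> + s) = 0" "max (- r) (min 0 s) = s" using that by (auto simp: c_def)
      then show ?thesis by (subst fp) (simp add: P_def)
    qed
    show "Y z t = Y z \<tau> + integral {\<tau>..t} (rhs (Y z))" if "t \<in> {\<tau>..T}" for t
      using fp[of t] fp[of \<tau>] r_nonneg c_eq[OF that] c_eq[of \<tau>] that T by (simp add: P_def)
  qed
qed

section \<open>Global solutions and the value \<open>sol\<close>\<close>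

lemma is_solution_continuous:
  assumes "is_solution r a B \<tau> \<phi> x" "\<tau> \<le> t"
  shows "continuous_on {t-r..u} x"
  using assms unfolding is_solution_def by (auto elim: continuous_on_subset)

lemma is_solution_deriv:
  assumes "is_solution r a B \<tau> \<phi> x" "\<tau> \<le> t0" "t \<in> {t0..t1}"
  shows "(x has_real_derivative rhs x t) (at t within {t0..t1})"
proof (rule DERIV_subset)
  show "(x has_real_derivative rhs x t) (at t within {\<tau>..})"
    using assms unfolding is_solution_def rhs_def by auto
qed (use assms in auto)

lemma is_solution_integral:
  assumes x: "is_solution r a B \<tau> \<phi> x" and t: "\<tau> \<le> t"
  shows "x t = x \<tau> + integral {\<tau>..t} (rhs x)"
proof -
  have "(rhs x has_integral (x t - x \<tau>)) {\<tau>..t}"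
    using is_solution_deriv[OF x order_refl] t
    by (intro fundamental_theorem_of_calculus) (auto simp: has_real_derivative_iff_has_vector_derivative)
  then show ?thesis by (simp add: integral_unique)
qed

lemma is_solution_init:
  assumes "is_solution r a B \<tau> \<phi> x" "s \<in> {\<tau>-r..\<tau>}"
  shows "x s = \<phi> (s - \<tau>)"
proof -
  have "segment r x \<tau> (s - \<tau>) = \<phi> (s - \<tau>)"
    using assms(1) by (simp add: is_solution_def)
  then show ?thesis
    using assms(2) by (simp add: segment_def)
qed

lemma is_solution_unique:
  assumes "is_solution r a B \<tau> \<phi> x" "is_solution r a B \<tau> \<phi> y" "t \<ge> \<tau> - r"
  shows "x t = y t"
proof (rule solution_unique_on[where x = x and y = y and t = t and T = t and \<tau> = \<tau>])
  show "continuous_on {\<tau>-r..t} x" "continuous_on {\<tau>-r..t} y"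
    using assms by (auto intro: is_solution_continuous)
  show "x s = y s" if "s \<in> {\<tau>-r..\<tau>}" for s
    using is_solution_init[OF assms(1) that] is_solution_init[OF assms(2) that] by simp
  show "x s = x \<tau> + integral {\<tau>..s} (rhs x)" if "s \<in> {\<tau>..t}" for s
    using that by (intro is_solution_integral[OF assms(1)]) simp
  show "y s = y \<tau> + integral {\<tau>..s} (rhs y)" if "s \<in> {\<tau>..t}" for s
    using that by (intro is_solution_integral[OF assms(2)]) simp
  show "t \<in> {\<tau>-r..t}"
    using assms(3) by simp
qed

text \<open>Solutions on the intervals up to \<open>\<tau> + n\<close> agree on their common domains
  by uniqueness and can therefore be glued. Being a solution is checked locally in time, inside one
  of these intervals.\<close>

lemma is_solution_exists:
  assumes \<phi>: "\<phi> \<in> Cset r"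
  obtains x where "is_solution r a B \<tau> \<phi> x"
proof -
  define Q where "Q n x \<longleftrightarrow> continuous_on {\<tau>-r..\<tau>+real n} x \<and> (\<forall>s\<in>{-r..0}. x (\<tau> + s) = \<phi> s) \<and>
      (\<forall>t\<in>{\<tau>..\<tau>+real n}. x t = x \<tau> + integral {\<tau>..t} (rhs x))" for n x
  have "\<exists>x. Q n x" for n
    unfolding Q_def by (rule solution_exists_on[OF \<phi>]) simp
  then obtain X where Q: "\<And>n. Q n (X n)"
    by metis
  have X: "continuous_on {\<tau>-r..\<tau>+real n} (X n)"
    "s \<in> {-r..0} \<Longrightarrow> X n (\<tau> + s) = \<phi> s"
    "t \<in> {\<tau>..\<tau>+real n} \<Longrightarrow> X n t = X n \<tau> + integral {\<tau>..t} (rhs (X n))" for n s t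
    using Q[of n] unfolding Q_def by blast+
  have X_eq: "X m t = X n t" if t: "t \<in> {\<tau>-r..\<tau>+m}" "t \<in> {\<tau>-r..\<tau>+n}" for m n t
  proof (rule solution_unique_on[where x = "X m" and y = "X n" and t = t
        and T = "\<tau> + min (real m) (real n)" and \<tau> = \<tau>])
    show "X m s = X n s" if "s \<in> {\<tau>-r..\<tau>}" for s
      using X(2)[of "s - \<tau>" m] X(2)[of "s - \<tau>" n] that by simp
    show "continuous_on {\<tau>-r..\<tau> + min (real m) (real n)} (X m)"
      by (rule continuous_on_subset[OF X(1)[of m]]) auto
    show "continuous_on {\<tau>-r..\<tau> + min (real m) (real n)} (X n)"
      by (rule continuous_on_subset[OF X(1)[of n]]) auto
  qed (use t in \<open>auto intro!: X(3)\<close>)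
  \<comment> \<open>The rounded-up index puts \<open>t\<close> in the domain of the chosen solution,
    and is 0 on the initial interval; \<open>X_eq\<close> makes the choice immaterial.\<close>
  define x where "x t = X (nat \<lceil>t - \<tau>\<rceil>) t" for t
  have x_eq: "x t = X n t" if "t \<in> {\<tau>-r..\<tau>+n}" for n t
    unfolding x_def
  proof (rule X_eq[OF _ that])
    have "t - \<tau> \<le> real (nat \<lceil>t - \<tau>\<rceil>)" by linarith
    then show "t \<in> {\<tau>-r..\<tau>+real (nat \<lceil>t - \<tau>\<rceil>)}" using that by auto
  qed
  \<comment> \<open>Points strictly left of \<open>\<tau> + n\<close> do not see the right end of
    the interval, so limits within the interval are limits within the half-line.\<close>
  have within: "at t within {c..} = at t within {c..\<tau>+real n}" if "t < \<tau> + n" for t c n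
    using that by (intro at_within_nhd[of t "{..<\<tau>+real n}"]) auto
  have "is_solution r a B \<tau> \<phi> x"
    unfolding is_solution_def
  proof (intro conjI allI impI)
    show "segment r x \<tau> = \<phi>"
    proof
      \<comment> \<open>Outside \<open>{-r..0}\<close> both functions are \<open>undefined\<close>,
        because \<open>\<phi>\<close> is extensional.\<close>
      fix s
      show "segment r x \<tau> s = \<phi> s"
        using \<phi> X(2)[of s 0] x_eq[of "\<tau> + s" 0]
        by (auto simp: segment_def mem_Cset_iff extensional_def)
    qed
    have "continuous (at t within {\<tau>-r..}) x" if t: "t \<ge> \<tau>-r" for t
    proof -
      obtain n :: nat where n: "t - \<tau> < n" using reals_Archimedean2 by blast
      have "continuous_on {\<tau>-r..\<tau>+n} x"
        using X(1)[of n] by (rule continuous_on_eq) (metis x_eq)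
      then show ?thesis
        using n t by (subst within[of t n]) (auto simp: continuous_on_eq_continuous_within)
    qed
    then show "continuous_on {\<tau>-r..} x" by (simp add: continuous_on_eq_continuous_within)
    fix t assume t: "t \<ge> \<tau>"
    obtain n :: nat where n: "t - \<tau> < n" using reals_Archimedean2 by blast
    have "((\<lambda>t. X n \<tau> + integral {\<tau>..t} (rhs (X n))) has_real_derivative 0 + rhs (X n) t) (at t within {\<tau>..\<tau>+n})"
      using n t by (intro derivative_intros integral_has_real_derivative continuous_on_rhs X(1)) auto
    moreover have "x u = X n \<tau> + integral {\<tau>..u} (rhs (X n))" if "u \<in> {\<tau>..\<tau>+n}" for u
      using X(3)[OF that] x_eq[of u n] that r_nonneg by simp
    ultimately have "(x has_real_derivative rhs (X n) t) (at t within {\<tau>..\<tau>+n})"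
      using n t by (intro has_field_derivative_transform_within[where d = 1 and g = x]) auto
    moreover have "rhs (X n) t = rhs x t"
    proof (rule rhs_cong)
      show "X n u = x u" if "u \<in> {t-r..t}" for u
        using x_eq[of u n] that n t by simp
    qed
    ultimately show "(x has_real_derivative - a t * x t + B t (segment r x t)) (at t within {\<tau>..})"
      using n by (subst within[of t n]) (auto simp: rhs_def)
  qed
  then show ?thesis by (rule that)
qed

text \<open>Uniqueness justifies the definite description, but only from \<open>\<tau> - r\<close>
  on, since a solution is arbitrary further left.\<close>

lemma sol_eq:
  assumes "is_solution r a B \<tau> \<phi> x" "t \<ge> \<tau> - r"
  shows "sol r a B \<tau> \<phi> t = x t"
  unfolding sol_def
proof (rule the_equality)
  show "\<exists>y. is_solution r a B \<tau> \<phi> y \<and> y t = x t"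
    using assms(1) by blast
  show "u = x t" if "\<exists>y. is_solution r a B \<tau> \<phi> y \<and> y t = u" for u
    using that is_solution_unique[OF assms(1) _ assms(2)] by auto
qed

section \<open>Variation of constants and bounds on solutions\<close>

lemma variation_of_constants:
  assumes x: "is_solution r a B \<tau> \<phi> x" and t: "\<tau> \<le> t0" "t0 \<le> t"
  shows "x t = E a t t0 * x t0 + integral {t0..t} (\<lambda>s. E a t s * B s (segment r x s))"
proof -
  \<comment> \<open>\<open>exp (A s)\<close> is the integrating factor: in the derivative of
    \<open>exp (A s) * x s\<close> the terms with \<open>a\<close> cancel. Multiplying by
    \<open>exp (- A t)\<close> afterwards recovers \<open>E\<close>.\<close>
  define A where "A s = integral {t0..s} a" for s
  have a_int: "a integrable_on {u..v}" for u v
    by (intro integrable_continuous_real continuous_on_subset[OF a_cont]) auto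
  have E: "E a t s = exp (- A t) * exp (A s)" if "s \<in> {t0..t}" for s
    using that Henstock_Kurzweil_Integration.integral_combine[of t0 s t a, OF _ _ a_int]
    by (simp add: E_def A_def flip: exp_add)
  have "((\<lambda>s. exp (A s) * B s (segment r x s)) has_integral exp (A t) * x t - exp (A t0) * x t0) {t0..t}"
  proof (rule fundamental_theorem_of_calculus[OF t(2)])
    fix s assume s: "s \<in> {t0..t}"
    have "(A has_real_derivative a s) (at s within {t0..t})"
      unfolding A_def[abs_def]
      by (rule integral_has_real_derivative[OF continuous_on_subset[OF a_cont] s]) simp
    moreover have "(x has_real_derivative rhs x s) (at s within {t0..t})"
      by (rule is_solution_deriv[OF x t(1) s])
    ultimately have "((\<lambda>s. exp (A s) * x s) has_real_derivative exp (A s) * B s (segment r x s)) (at s within {t0..t})"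
      by (auto intro!: derivative_eq_intros simp: rhs_def algebra_simps)
    then show "((\<lambda>s. exp (A s) * x s) has_vector_derivative exp (A s) * B s (segment r x s)) (at s within {t0..t})"
      by (simp add: has_real_derivative_iff_has_vector_derivative)
  qed
  then have "((\<lambda>s. exp (- A t) * (exp (A s) * B s (segment r x s))) has_integral
      exp (- A t) * (exp (A t) * x t - exp (A t0) * x t0)) {t0..t}"
    by (rule has_integral_mult_right)
  moreover have "exp (- A t) * (exp (A t) * x t - exp (A t0) * x t0) = x t - E a t t0 * x t0"
    using E[of t0] t by (simp add: algebra_simps flip: exp_add)
  ultimately have "((\<lambda>s. exp (- A t) * (exp (A s) * B s (segment r x s))) has_integral x t - E a t t0 * x t0) {t0..t}"
    by simp
  then have "((\<lambda>s. E a t s * B s (segment r x s)) has_integral x t - E a t t0 * x t0) {t0..t}"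
    by (rule has_integral_eq[rotated]) (simp add: E)
  then show ?thesis by (simp add: integral_unique)
qed

text \<open>The bound \<open>S\<close> must reach back to \<open>t0 - r\<close> because the segments
  do. Since \<open>K\<close> is nonnegative, the integral from \<open>t0\<close> is at most the one
  from \<open>\<tau>\<close>, so one \<open>k\<close> serves for every restarting time.\<close>

lemma abs_solution_le:
  assumes x: "is_solution r a B \<tau> \<phi> x" and t: "\<tau> \<le> t0" "t0 \<le> t"
    and S: "\<And>u. u \<in> {t0-r..t} \<Longrightarrow> \<bar>x u\<bar> \<le> S" and k: "integral {\<tau>..t} (K a b t) \<le> k"
  shows "\<bar>x t\<bar> \<le> E a t t0 * \<bar>x t0\<bar> + k * S"
proof -
  have S0: "S \<ge> 0" using S[of t] t r_nonneg by fastforce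
  have K_int: "K a b t integrable_on {u..t}" for u
    by (intro integrable_continuous_real continuous_on_K a_cont b_cont)
  have K_nonneg: "K a b t s \<ge> 0" for s
    using b_nonneg E_pos[of a t s] by (simp add: K_def)
  have "\<bar>integral {t0..t} (\<lambda>s. E a t s * B s (segment r x s))\<bar> \<le> integral {t0..t} (\<lambda>s. K a b t s * S)"
    unfolding real_norm_def[symmetric]
  proof (rule integral_norm_bound_integral)
    show "(\<lambda>s. E a t s * B s (segment r x s)) integrable_on {t0..t}"
      using t by (intro integrable_continuous_real continuous_intros continuous_on_E a_cont
          continuous_on_B_segment is_solution_continuous[OF x])
    show "(\<lambda>s. K a b t s * S) integrable_on {t0..t}"
      by (intro integrable_on_mult_left K_int)
    fix s assume s: "s \<in> {t0..t}"
    have "\<bar>B s (segment r x s)\<bar> \<le> b s * S"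
      using s t by (intro abs_B_segment_le is_solution_continuous[OF x] S) auto
    then have "E a t s * \<bar>B s (segment r x s)\<bar> \<le> E a t s * (b s * S)"
      by (intro mult_left_mono) (auto simp: E_pos less_imp_le)
    then show "norm (E a t s * B s (segment r x s)) \<le> K a b t s * S"
      using E_pos[of a t s] by (simp add: abs_mult K_def mult_ac)
  qed
  also have "\<dots> = integral {t0..t} (K a b t) * S"
    by (rule integral_mult_left)
  also have "\<dots> \<le> k * S"
  proof (rule mult_right_mono[OF _ S0])
    have "integral {t0..t} (K a b t) \<le> integral {\<tau>..t} (K a b t)"
      using t K_nonneg by (intro integral_subset_le K_int) auto
    then show "integral {t0..t} (K a b t) \<le> k" using k by simp
  qed
  finally have "\<bar>integral {t0..t} (\<lambda>s. E a t s * B s (segment r x s))\<bar> \<le> k * S" .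
  moreover have "\<bar>E a t t0 * x t0\<bar> = E a t t0 * \<bar>x t0\<bar>"
    using E_pos[of a t t0] by (simp add: abs_mult)
  ultimately show ?thesis
    using variation_of_constants[OF x t] by linarith
qed

text \<open>At a point \<open>p\<close> where \<open>\<bar>x\<bar>\<close> is maximal,
  \<open>abs_solution_le\<close> applies with \<open>S = \<bar>x p\<bar>\<close>, and the delayed
  term is absorbed on the left because \<open>k < 1\<close>. If \<open>p\<close> lies in the initial
  window, \<open>C \<ge> 1\<close> suffices.\<close>

lemma solution_bounded:
  assumes x: "is_solution r a B \<tau> \<phi> x" and t0: "\<tau> \<le> t0"
    and C: "C \<ge> 1" "\<And>t. t \<ge> t0 \<Longrightarrow> E a t t0 \<le> C"
    and k: "0 \<le> k" "k < 1" "\<And>t. t \<ge> \<tau> \<Longrightarrow> integral {\<tau>..t} (K a b t) \<le> k"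
    and t: "t \<ge> t0 - r"
  shows "\<bar>x t\<bar> \<le> C / (1 - k) * sup_norm r (segment r x t0)"
proof -
  define N where "N = sup_norm r (segment r x t0)"
  have N: "\<bar>x u\<bar> \<le> N" if "u \<in> {t0-r..t0}" for u
    unfolding N_def using that t0 by (intro abs_le_sup_norm_segment is_solution_continuous[OF x]) auto
  have N0: "N \<ge> 0" using N[of t0] r_nonneg by simp
  \<comment> \<open>The right end \<open>max t t0\<close> keeps the initial window inside the
    interval even for \<open>t < t0\<close>.\<close>
  have "continuous_on {t0-r..max t t0} (\<lambda>u. \<bar>x u\<bar>)"
    by (intro continuous_intros is_solution_continuous[OF x t0])
  moreover have "compact {t0-r..max t t0}" "{t0-r..max t t0} \<noteq> {}" using r_nonneg by auto
  ultimately obtain p where p: "p \<in> {t0-r..max t t0}" "\<And>u. u \<in> {t0-r..max t t0} \<Longrightarrow> \<bar>x u\<bar> \<le> \<bar>x p\<bar>"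
    using continuous_attains_sup by meson
  have "(1 - k) * \<bar>x p\<bar> \<le> C * N"
  proof (cases "p \<le> t0")
    case True
    have "(1 - k) * \<bar>x p\<bar> \<le> 1 * N"
      using N[of p] True p(1) k by (intro mult_mono) auto
    also have "\<dots> \<le> C * N" using C(1) N0 by (intro mult_right_mono)
    finally show ?thesis .
  next
    case False
    have "\<bar>x p\<bar> \<le> E a p t0 * \<bar>x t0\<bar> + k * \<bar>x p\<bar>"
      using False t0 p(1) by (intro abs_solution_le[OF x] p(2) k(3)) auto
    also have "E a p t0 * \<bar>x t0\<bar> \<le> C * N"
      using C False N[of t0] r_nonneg by (intro mult_mono) auto
    finally show ?thesis by (simp add: algebra_simps)
  qed
  then have "\<bar>x p\<bar> \<le> C / (1 - k) * N"
    using k(2) by (simp add: field_simps)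
  then show ?thesis using p(2)[of t] t unfolding N_def by simp
qed

lemma solution_tendsto_zero:
  assumes div: "\<And>N. \<forall>\<^sub>F t in at_top. \<forall>s. integral {s..s + t} a \<ge> N"
    and x: "is_solution r a B \<tau> \<phi> x"
    and k: "0 \<le> k" "k < 1" "\<And>t. t \<ge> \<tau> \<Longrightarrow> integral {\<tau>..t} (K a b t) \<le> k"
  shows "(x \<longlongrightarrow> 0) at_top"
proof -
  obtain C where C: "C \<ge> 1" "\<And>t. t \<ge> \<tau> \<Longrightarrow> E a t \<tau> \<le> C"
    using E_bounded[OF a_cont div] by blast
  define M where "M = C / (1 - k) * sup_norm r (segment r x \<tau>)"
  have M: "\<bar>x t\<bar> \<le> M" if "t \<ge> \<tau> - r" for t
    unfolding M_def by (rule solution_bounded[OF x order_refl C k that])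
  have M0: "M \<ge> 0" using M[of \<tau>] r_nonneg by simp
  \<comment> \<open>Midway between \<open>k\<close> and 1: the delayed term uses up
    \<open>k\<close>, and waiting for \<open>E\<close> to fall to \<open>(1 - k) / 2\<close> uses
    the rest.\<close>
  define q where "q = (1 + k) / 2"
  have q: "0 < q" "q < 1" "(1 - k) / 2 + k = q" using k by (auto simp: q_def field_simps)
  obtain T where T: "T > 0" "\<And>s t. t \<ge> s + T \<Longrightarrow> E a t s \<le> (1 - k) / 2"
    using E_uniform_decay[OF div, of "(1 - k) / 2"] k by auto
  have ev: "\<exists>t1\<ge>\<tau>. \<forall>t\<ge>t1-r. \<bar>x t\<bar> \<le> M * q ^ n" for n
  proof (induction n)
    case 0
    then show ?case using M by auto
  next
    case (Suc n)
    then obtain t1 where t1: "t1 \<ge> \<tau>" "\<And>t. t \<ge> t1 - r \<Longrightarrow> \<bar>x t\<bar> \<le> M * q ^ n" by blast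
    have "\<bar>x t\<bar> \<le> M * q ^ Suc n" if "t \<ge> t1 + T" for t
    proof -
      have "\<bar>x t\<bar> \<le> E a t t1 * \<bar>x t1\<bar> + k * (M * q ^ n)"
        using that t1 T(1) by (intro abs_solution_le[OF x] k(3)) auto
      also have "E a t t1 * \<bar>x t1\<bar> \<le> (1 - k) / 2 * (M * q ^ n)"
        using T(2)[OF that] t1(2)[of t1] r_nonneg k by (intro mult_mono) auto
      finally show ?thesis
        unfolding q(3)[symmetric] power_Suc by (simp add: algebra_simps)
    qed
    \<comment> \<open>The extra \<open>r\<close> places the whole delay window at the new starting
      time beyond \<open>t1 + T\<close>.\<close>
    then show ?case
      using t1(1) T(1) r_nonneg by (intro exI[of _ "t1 + T + r"]) auto
  qed
  have "(\<lambda>n. M * q ^ n) \<longlonglongrightarrow> M * 0"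
    using q by (intro tendsto_intros LIMSEQ_power_zero) auto
  show ?thesis
  proof (rule tendstoI)
    fix e :: real assume "e > 0"
    with \<open>(\<lambda>n. M * q ^ n) \<longlonglongrightarrow> M * 0\<close> have "\<forall>\<^sub>F n in sequentially. M * q ^ n < e"
      by (intro order_tendstoD) auto
    then obtain n where n: "M * q ^ n < e" by (auto simp: eventually_sequentially)
    obtain t1 where t1: "\<And>t. t \<ge> t1 - r \<Longrightarrow> \<bar>x t\<bar> \<le> M * q ^ n" using ev by blast
    have "dist (x t) 0 < e" if "t \<ge> t1 - r" for t
      using t1[OF that] n by (simp add: dist_real_def)
    then show "\<forall>\<^sub>F t in at_top. dist (x t) 0 < e"
      unfolding eventually_at_top_linorder by blast
  qed
qed

section \<open>Global asymptotic and global exponential stability\<close>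

theorem GAS_if_kappa_less_1:
  assumes div: "\<And>N. \<forall>\<^sub>F t in at_top. \<forall>s. integral {s..s + t} a \<ge> N"
    and kappa: "\<And>\<tau>. kappa a b \<tau> < 1"
  shows "GAS r a B"
  unfolding GAS_def
proof (intro conjI allI impI ballI)
  fix \<tau> \<epsilon> :: real assume \<epsilon>: "\<epsilon> > 0"
  obtain k where k: "k \<ge> 0" "k < 1" "\<And>t. t \<ge> \<tau> \<Longrightarrow> integral {\<tau>..t} (K a b t) \<le> k"
    using kappa_less_1[OF kappa[of \<tau>]] by blast
  obtain C where C: "C \<ge> 1" "\<And>t. t \<ge> \<tau> \<Longrightarrow> E a t \<tau> \<le> C"
    using E_bounded[OF a_cont div] by blast
  \<comment> \<open>The gain from the initial norm to the solution, so \<open>\<epsilon> / c\<close>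
    serves as \<open>\<delta>\<close>.\<close>
  define c where "c = C / (1 - k)"
  have c: "c > 0" using C k by (simp add: c_def)
  have "\<bar>sol r a B \<tau> \<phi> t\<bar> < \<epsilon>" if t: "t \<ge> \<tau>" and \<phi>: "\<phi> \<in> Cset r" and small: "sup_norm r \<phi> < \<epsilon> / c" for t \<phi>
  proof -
    obtain x where x: "is_solution r a B \<tau> \<phi> x" using is_solution_exists[OF \<phi>] .
    have "\<bar>x t\<bar> \<le> c * sup_norm r (segment r x \<tau>)"
      unfolding c_def using t r_nonneg by (intro solution_bounded[OF x order_refl C k]) auto
    also have "\<dots> < \<epsilon>"
      using x small c by (simp add: is_solution_def field_simps)
    finally show ?thesis using sol_eq[OF x, of t] t r_nonneg by simp
  qed
  then show "\<exists>\<delta>>0. \<forall>t\<ge>\<tau>. \<forall>\<phi>\<in>Cset r. sup_norm r \<phi> < \<delta> \<longrightarrow> \<bar>sol r a B \<tau> \<phi> t\<bar> < \<epsilon>"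
    using \<epsilon> c by (intro exI[of _ "\<epsilon> / c"]) auto
next
  fix \<tau> \<phi> assume \<phi>: "\<phi> \<in> Cset r"
  obtain k where k: "k \<ge> 0" "k < 1" "\<And>t. t \<ge> \<tau> \<Longrightarrow> integral {\<tau>..t} (K a b t) \<le> k"
    using kappa_less_1[OF kappa[of \<tau>]] by blast
  obtain x where x: "is_solution r a B \<tau> \<phi> x" using is_solution_exists[OF \<phi>] .
  have "(x \<longlongrightarrow> 0) at_top"
    by (rule solution_tendsto_zero[OF div x k])
  moreover have "\<forall>\<^sub>F t in at_top. x t = sol r a B \<tau> \<phi> t"
    using eventually_ge_at_top[of "\<tau> - r"] by eventually_elim (simp add: sol_eq[OF x])
  ultimately show "(sol r a B \<tau> \<phi> \<longlongrightarrow> 0) at_top"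
    by (rule Lim_transform_eventually)
qed

text \<open>The uniform bound \<open>\<theta>\<close> on \<open>E\<close> makes the gain
  \<open>D\<close> the same for every restarting time. The segment norm then contracts relative to
  its own current value over steps of fixed length, with a rate independent of
  \<open>\<phi>\<close>.\<close>

theorem GEAS_if_kappa_less:
  assumes div: "\<And>N. \<forall>\<^sub>F t in at_top. \<forall>s. integral {s..s + t} a \<ge> N"
    and kappa: "\<And>\<tau>. kappa a b \<tau> < 1 / (1 + vartheta a \<tau>)"
  shows "GEAS r a B"
  unfolding GEAS_def
proof
  fix \<tau>
  obtain k \<theta> where k: "k \<ge> 0" "\<theta> \<ge> 1" "k * (1 + \<theta>) < 1"
    "\<And>t. t \<ge> \<tau> \<Longrightarrow> integral {\<tau>..t} (K a b t) \<le> k"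
    "\<And>s t. \<tau> \<le> s \<Longrightarrow> s \<le> t \<Longrightarrow> E a t s \<le> \<theta>"
    using kappa_vartheta_finite[OF kappa[of \<tau>]] by blast
  have "k * 1 \<le> k * (1 + \<theta>)" using k(1,2) by (intro mult_left_mono) auto
  then have k1: "k < 1" using k(3) by simp
  define D where "D = \<theta> / (1 - k)"
  have D: "D > 0" using k k1 by (simp add: D_def)
  \<comment> \<open>\<open>k * D < 1\<close> says \<open>k * \<theta> < 1 - k\<close>, which is
    \<open>k * (1 + \<theta>) < 1\<close> rearranged.\<close>
  have kD: "0 \<le> k * D" "k * D < 1" using k k1 D by (auto simp: D_def field_simps)
  define q where "q = (1 + k * D) / 2"
  have q: "0 < q" "q < 1" "(1 - k * D) / 2 + k * D = q" using kD by (auto simp: q_def field_simps)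
  obtain T0 where T0: "T0 > 0" "\<And>s t. t \<ge> s + T0 \<Longrightarrow> E a t s \<le> (1 - k * D) / 2"
    using E_uniform_decay[OF div, of "(1 - k * D) / 2"] kD by auto
  \<comment> \<open>With the added \<open>r\<close>, the whole window ending at
    \<open>t0 + T\<close> lies beyond \<open>t0 + T0\<close>.\<close>
  define T where "T = T0 + r"
  have T: "T > 0" using T0 r_nonneg by (simp add: T_def)
  \<comment> \<open>Chosen so that \<open>exp (- \<gamma> * T) = q\<close>.\<close>
  define \<gamma> where "\<gamma> = - ln q / T"
  have \<gamma>: "\<gamma> > 0"
    using q T divide_neg_pos[of "ln q" T] by (simp add: \<gamma>_def ln_less_zero)
  have "\<bar>sol r a B \<tau> \<phi> t\<bar> \<le> D / q * sup_norm r \<phi> * exp (- \<gamma> * (t - \<tau>))"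
    if t: "t \<ge> \<tau>" and \<phi>: "\<phi> \<in> Cset r" for t \<phi>
  proof -
    obtain x where x: "is_solution r a B \<tau> \<phi> x" using is_solution_exists[OF \<phi>] .
    define N where "N t0 = sup_norm r (segment r x t0)" for t0
    have x_le: "\<bar>x u\<bar> \<le> D * N t0" if "t0 \<ge> \<tau>" "u \<ge> t0 - r" for t0 u
      unfolding D_def N_def using that k(5)
      by (intro solution_bounded[OF x _ k(2) _ k(1) k1 k(4)]) auto
    have step: "N (t0 + T) \<le> q * N t0" if t0: "t0 \<ge> \<tau>" for t0
      unfolding N_def[of "t0 + T"]
    proof (rule sup_norm_segment_le[OF r_nonneg])
      fix u assume "u \<in> {t0 + T - r..t0 + T}"
      then have u: "u \<ge> t0 + T0" by (simp add: T_def)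
      have "\<bar>x u\<bar> \<le> E a u t0 * \<bar>x t0\<bar> + k * (D * N t0)"
        using u t0 T0(1) by (intro abs_solution_le[OF x] x_le k(4)) auto
      also have "E a u t0 * \<bar>x t0\<bar> \<le> (1 - k * D) / 2 * N t0"
        unfolding N_def using T0(2)[OF u] kD t0 r_nonneg
        by (intro mult_mono abs_le_sup_norm_segment is_solution_continuous[OF x]) auto
      finally have "\<bar>x u\<bar> \<le> ((1 - k * D) / 2 + k * D) * N t0"
        by (simp add: algebra_simps)
      then show "\<bar>x u\<bar> \<le> q * N t0" by (simp only: q(3))
    qed
    have N_le: "N (\<tau> + j * T) \<le> q ^ j * N \<tau>" for j :: nat
    proof (induction j)
      case (Suc j)
      have "N (\<tau> + Suc j * T) \<le> q * N (\<tau> + j * T)"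
        using step[of "\<tau> + j * T"] T by (simp add: algebra_simps)
      also have "\<dots> \<le> q * (q ^ j * N \<tau>)" using Suc q by (intro mult_left_mono) auto
      finally show ?case by simp
    qed simp
    define j where "j = nat \<lfloor>(t - \<tau>) / T\<rfloor>"
    have j: "j \<le> (t - \<tau>) / T" "(t - \<tau>) / T - 1 \<le> j"
      using t T by (auto simp: j_def)
    have N\<tau>: "N \<tau> = sup_norm r \<phi>" using x by (simp add: N_def is_solution_def)
    \<comment> \<open>Up to \<open>t\<close> there are \<open>j\<close> full steps, and the
      incomplete last one costs a factor \<open>1 / q\<close>. The inequality for \<open>j\<close>
      reverses because \<open>ln q\<close> is negative.\<close>
    have qj: "q ^ j \<le> exp (- \<gamma> * (t - \<tau>)) / q"
    proof -
      have "q ^ j = exp (j * ln q)" using q by (simp add: exp_of_nat_mult)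
      also have "\<dots> \<le> exp (((t - \<tau>) / T - 1) * ln q)"
        using j(2) q by (simp add: mult_right_mono_neg)
      also have "((t - \<tau>) / T - 1) * ln q = - \<gamma> * (t - \<tau>) - ln q"
        using T by (simp add: \<gamma>_def field_simps)
      also have "exp (- \<gamma> * (t - \<tau>) - ln q) = exp (- \<gamma> * (t - \<tau>)) / q"
        using q by (simp add: exp_diff)
      finally show ?thesis .
    qed
    have "\<bar>x t\<bar> \<le> D * N (\<tau> + j * T)"
      using j(1) T r_nonneg by (intro x_le) (auto simp: field_simps)
    also have "\<dots> \<le> D * (q ^ j * N \<tau>)"
      using D by (intro mult_left_mono N_le) auto
    also have "\<dots> \<le> D * (exp (- \<gamma> * (t - \<tau>)) / q * N \<tau>)"
      using D sup_norm_nonneg[OF r_nonneg \<phi>] unfolding N\<tau>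
      by (intro mult_left_mono mult_right_mono qj) auto
    finally show ?thesis
      using sol_eq[OF x, of t] t r_nonneg by (simp add: N\<tau> mult_ac)
  qed
  then show "\<exists>M>0. \<exists>\<gamma>>0. \<forall>t\<ge>\<tau>. \<forall>\<phi>\<in>Cset r.
      \<bar>sol r a B \<tau> \<phi> t\<bar> \<le> M * sup_norm r \<phi> * exp (- \<gamma> * (t - \<tau>))"
    using D q \<gamma> by (intro exI[of _ "D / q"] exI[of _ \<gamma>] conjI) auto
qed

end

theorem proposition3p3:
  fixes r :: real and a b :: "real \<Rightarrow> real" and B :: "real \<Rightarrow> (real \<Rightarrow> real) \<Rightarrow> real"
  assumes r_nonneg: "r \<ge> 0"
    and a_cont: "continuous_on UNIV a"
    and B_cont: "continuous_map (prod_topology euclidean (mtopology_of (Cspace r))) euclidean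
                   (\<lambda>(t, \<phi>). B t \<phi>)"
    and B_lipschitz: "\<And>c d R. R > 0 \<Longrightarrow>
       \<exists>L>0. \<forall>t\<in>{c..d}. \<forall>\<phi>\<in>Cset r. \<forall>\<phi>'\<in>Cset r. sup_norm r \<phi> \<le> R \<longrightarrow> sup_norm r \<phi>' \<le> R \<longrightarrow>
         \<bar>B t \<phi> - B t \<phi>'\<bar> \<le> L * sup_norm r (\<lambda>s. \<phi> s - \<phi>' s)"
    and b_cont: "continuous_on UNIV b"
    and b_nonneg: "\<And>t. b t \<ge> 0"
    and B_bound: "\<And>t \<phi>. \<phi> \<in> Cset r \<Longrightarrow> \<bar>B t \<phi>\<bar> \<le> b t * sup_norm r \<phi>"
    and a_diverges: "\<And>N. \<forall>\<^sub>F t in at_top. \<forall>s. integral {s..s + t} a \<ge> N"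
  shows "((\<forall>\<tau>. kappa a b \<tau> < 1) \<longrightarrow> GAS r a B) \<and>
         ((\<forall>\<tau>. kappa a b \<tau> < 1 / (1 + vartheta a \<tau>)) \<longrightarrow> GEAS r a B)"
proof -
  interpret delay_equation r a b B
    by standard fact+
  show ?thesis
    using GAS_if_kappa_less_1[OF a_diverges] GEAS_if_kappa_less[OF a_diverges] by blast
qed

end
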